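(* Let $V$ be a finite dimensional vector space over a field $\mathbb{K}$ and let $\top_V$ be a vector space locality relation on $V$. Let $\top_{V,G}$ be the relation on the lattice $G(V)$ of linear subspaces of $V$ given by $U\,\top_{V,G}\,W\iff u\,\top_V\,w$ for all $u\in U$, $w\in W$. Then: (a) $\top_V$ is non-degenerate if and only if $(G(V),\top_{V,G})$ is a locality lattice which has the separating property: $U\,\top_{V,G}\,W\Rightarrow U\cap W=\{0\}$ for all $U,W\in G(V)$. (b) $\top_V$ is strongly non-degenerate if and only if $(G(V),\top_{V,G})$ is a strongly separating locality lattice. In this case, the map $U\mapsto U^{\top_V}$ defines an orthocomplementation on $G(V)$.
   Context: For a symmetric binary relation $\top$ on a set $X$ and $A\subseteq X$, the polar set is $A^\top:=\{x'\in X\mid x\,\top\, x'\text{ for all }x\in A\}$; $a^\top:=\{a\}^\top$ for $a\in X$. A vector space locality relation on $V$ is a symmetric binary relation $\top$ on $V$ such that $X^\top$ is a linear subspace of $V$ for every subset $X\subseteq V$. It is non-degenerate if $v\,\top\, v\Rightarrow v=0$ for every $v\in V$; it is strongly non-degenerate if moreover, for every linear subspace $U\subsetneq V$, the polar space $U^\top$ is nonzero. $G(V)$ is the set of linear subspaces of $V$ ordered by inclusion; it is a bounded lattice with join $+$, meet $\cap$, least element $\{0\}$ and greatest element $V$. For a bounded lattice $(L,\leq,0,1)$: a poset ideal is a subset $M$ with $a\in M$, $b\leq a\Rightarrow b\in M$; a lattice ideal is a poset ideal closed under $\vee$. $(L,\top)$ is a locality lattice if $\top$ is a symmetric binary relation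 on $L$ such that $a^\top$ is a lattice ideal for every $a\in L$. It is strongly separating if (a) $a\,\top\,b\Rightarrow a\wedge b=0$; (b) each $a^\top$ has a greatest element $\operatorname{grt}(a^\top)$; (c) $\operatorname{grt}((a^\top)^\top)=a$ for all $a\in L$. An orthocomplementation on $L$ is a map $\Psi\colon L\to L$ that is antitone ($b\leq a\Rightarrow\Psi(a)\leq\Psi(b)$), involutive ($\Psi^2=\mathrm{Id}$) and separating (if $b\leq a$ and $b\leq\Psi(a)$ then $b=0$). *)

theory Defs
  imports Complex_Main "HOL-Algebra.Lattice"
begin

definition polar :: "'a set \<Rightarrow> ('a \<Rightarrow> 'a \<Rightarrow> bool) \<Rightarrow> 'a set \<Rightarrow> 'a set" where
  "polar X R A = {x' \<in> X. \<forall>x\<in>A. R x x'}"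

section \<open>Locality relations on vector spaces\<close>

text \<open>The vector space is the whole type \<open>'v\<close>, with scalar multiplication \<open>scale\<close>.\<close>

definition vector_space_locality ::
    "('k::field \<Rightarrow> 'v::ab_group_add \<Rightarrow> 'v) \<Rightarrow> ('v \<Rightarrow> 'v \<Rightarrow> bool) \<Rightarrow> bool" where
  "vector_space_locality scale R \<longleftrightarrow>
     symp R \<and> (\<forall>X. module.subspace scale (polar UNIV R X))"

definition non_degenerate :: "('v::ab_group_add \<Rightarrow> 'v \<Rightarrow> bool) \<Rightarrow> bool" where
  "non_degenerate R \<longleftrightarrow> (\<forall>v. R v v \<longrightarrow> v = 0)"

definition strongly_non_degenerate ::
    "('k::field \<Rightarrow> 'v::ab_group_add \<Rightarrow> 'v) \<Rightarrow> ('v \<Rightarrow> 'v \<Rightarrow> bool) \<Rightarrow> bool" where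
  "strongly_non_degenerate scale R \<longleftrightarrow>
     non_degenerate R \<and>
     (\<forall>U. module.subspace scale U \<and> U \<subset> UNIV \<longrightarrow> polar UNIV R U \<noteq> {0})"

section \<open>Locality relations on lattices\<close>

definition poset_ideal :: "('a, 'b) gorder_scheme \<Rightarrow> 'a set \<Rightarrow> bool" where
  "poset_ideal L M \<longleftrightarrow>
     M \<subseteq> carrier L \<and> (\<forall>a\<in>M. \<forall>b\<in>carrier L. b \<sqsubseteq>\<^bsub>L\<^esub> a \<longrightarrow> b \<in> M)"

definition lattice_ideal :: "('a, 'b) gorder_scheme \<Rightarrow> 'a set \<Rightarrow> bool" where
  "lattice_ideal L M \<longleftrightarrow> poset_ideal L M \<and> (\<forall>a\<in>M. \<forall>b\<in>M. a \<squnion>\<^bsub>L\<^esub> b \<in> M)"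

definition locality_lattice :: "('a, 'b) gorder_scheme \<Rightarrow> ('a \<Rightarrow> 'a \<Rightarrow> bool) \<Rightarrow> bool" where
  "locality_lattice L R \<longleftrightarrow>
     bounded_lattice L \<and> symp_on (carrier L) R \<and>
     (\<forall>a\<in>carrier L. lattice_ideal L (polar (carrier L) R {a}))"

text \<open>Since greatest elements are unique, \<open>greatest L a A\<close> expresses both that the greatest
  element of \<open>A\<close> exists and that it equals \<open>a\<close>.\<close>

definition strongly_separating :: "('a, 'b) gorder_scheme \<Rightarrow> ('a \<Rightarrow> 'a \<Rightarrow> bool) \<Rightarrow> bool" where
  "strongly_separating L R \<longleftrightarrow>
     (\<forall>a\<in>carrier L. \<forall>b\<in>carrier L. R a b \<longrightarrow> a \<sqinter>\<^bsub>L\<^esub> b = \<bottom>\<^bsub>L\<^esub>) \<and>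
     (\<forall>a\<in>carrier L. \<exists>g. greatest L g (polar (carrier L) R {a})) \<and>
     (\<forall>a\<in>carrier L. greatest L a (polar (carrier L) R (polar (carrier L) R {a})))"

definition orthocomplementation :: "('a, 'b) gorder_scheme \<Rightarrow> ('a \<Rightarrow> 'a) \<Rightarrow> bool" where
  "orthocomplementation L \<Psi> \<longleftrightarrow>
     bounded_lattice L \<and>
     \<Psi> \<in> carrier L \<rightarrow> carrier L \<and>
     (\<forall>a\<in>carrier L. \<forall>b\<in>carrier L. b \<sqsubseteq>\<^bsub>L\<^esub> a \<longrightarrow> \<Psi> a \<sqsubseteq>\<^bsub>L\<^esub> \<Psi> b) \<and>
     (\<forall>a\<in>carrier L. \<Psi> (\<Psi> a) = a) \<and>
     (\<forall>a\<in>carrier L. \<forall>b\<in>carrier L. b \<sqsubseteq>\<^bsub>L\<^esub> a \<and> b \<sqsubseteq>\<^bsub>L\<^esub> \<Psi> a \<longrightarrow> b = \<bottom>\<^bsub>L\<^esub>)"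

section \<open>The lattice of subspaces\<close>

definition subspace_lattice ::
    "('k::field \<Rightarrow> 'v::ab_group_add \<Rightarrow> 'v) \<Rightarrow> 'v set gorder" where
  "subspace_lattice scale =
     \<lparr>carrier = {U. module.subspace scale U}, eq = (=), le = (\<subseteq>)\<rparr>"

definition subspace_locality :: "('v \<Rightarrow> 'v \<Rightarrow> bool) \<Rightarrow> 'v set \<Rightarrow> 'v set \<Rightarrow> bool" where
  "subspace_locality R U W \<longleftrightarrow> (\<forall>u\<in>U. \<forall>w\<in>W. R u w)"

text \<open>The lattice operations, which are determined by the order, are the expected ones.\<close>

context vector_space
begin

lemma partial_order_subspace_lattice: "partial_order (subspace_lattice scale)"
  by unfold_locales (auto simp: subspace_lattice_def)

lemma glb_subspace_lattice:
  assumes "subspace U" "subspace W"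
  shows "is_glb (subspace_lattice scale) (U \<inter> W) {U, W}"
  using assms by (auto simp: subspace_lattice_def greatest_def Lower_def subspace_inter)

lemma lub_subspace_lattice:
  assumes "subspace U" "subspace W"
  shows "is_lub (subspace_lattice scale) {u + w | u w. u \<in> U \<and> w \<in> W} {U, W}"
proof -
  let ?S = "{u + w | u w. u \<in> U \<and> w \<in> W}"
  have S: "subspace ?S" using subspace_sums[OF assms] by simp
  have U: "U \<subseteq> ?S"
  proof
    fix u assume "u \<in> U"
    then have "u = u + 0 \<and> u \<in> U \<and> 0 \<in> W" using subspace_0[OF assms(2)] by simp
    then show "u \<in> ?S" by blast
  qed
  have W: "W \<subseteq> ?S"
  proof
    fix w assume "w \<in> W"
    then have "w = 0 + w \<and> 0 \<in> U \<and> w \<in> W" using subspace_0[OF assms(1)] by simp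
    then show "w \<in> ?S" by blast
  qed
  have Y: "?S \<subseteq> Y" if "subspace Y" "U \<subseteq> Y" "W \<subseteq> Y" for Y
    using that subspace_add[OF that(1)] by blast
  have "is_lub (subspace_lattice scale) S {U, W}"
    if "subspace S" "U \<subseteq> S" "W \<subseteq> S"
      "\<And>Y. subspace Y \<Longrightarrow> U \<subseteq> Y \<Longrightarrow> W \<subseteq> Y \<Longrightarrow> S \<subseteq> Y" for S
    using assms that by (auto simp: subspace_lattice_def least_def Upper_def)
  from this[OF S U W Y] show ?thesis .
qed

lemma least_subspace_lattice:
  "least (subspace_lattice scale) {0} (carrier (subspace_lattice scale))"
  by (auto simp: subspace_lattice_def least_def subspace_0)

lemma greatest_subspace_lattice:
  "greatest (subspace_lattice scale) UNIV (carrier (subspace_lattice scale))"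
  by (auto simp: subspace_lattice_def greatest_def)

lemma bounded_lattice_subspace_lattice: "bounded_lattice (subspace_lattice scale)"
proof -
  interpret partial_order "subspace_lattice scale" by (rule partial_order_subspace_lattice)
  have carr: "subspace U" if "U \<in> carrier (subspace_lattice scale)" for U
    using that by (simp add: subspace_lattice_def)
  show ?thesis
  proof unfold_locales
    fix U W
    assume "U \<in> carrier (subspace_lattice scale)" "W \<in> carrier (subspace_lattice scale)"
    then have sub: "subspace U" "subspace W" by (auto dest: carr)
    show "\<exists>s. is_lub (subspace_lattice scale) s {U, W}"
      by (rule exI) (rule lub_subspace_lattice[OF sub])
    show "\<exists>s. is_glb (subspace_lattice scale) s {U, W}"
      by (rule exI) (rule glb_subspace_lattice[OF sub])
  qed (rule exI, rule least_subspace_lattice greatest_subspace_lattice)+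
qed

lemma meet_subspace_lattice:
  assumes "subspace U" "subspace W"
  shows "U \<sqinter>\<^bsub>subspace_lattice scale\<^esub> W = U \<inter> W"
  unfolding meet_def Lattice.inf_def
  using glb_subspace_lattice[OF assms]
  by (intro some_equality partial_order.greatest_unique[OF partial_order_subspace_lattice])

lemma join_subspace_lattice:
  assumes "subspace U" "subspace W"
  shows "U \<squnion>\<^bsub>subspace_lattice scale\<^esub> W = {u + w | u w. u \<in> U \<and> w \<in> W}"
  unfolding join_def Lattice.sup_def
  using lub_subspace_lattice[OF assms]
  by (intro some_equality partial_order.least_unique[OF partial_order_subspace_lattice])

lemma bottom_subspace_lattice: "\<bottom>\<^bsub>subspace_lattice scale\<^esub> = {0}"
  unfolding bottom_def
  using least_subspace_lattice
  by (intro some_equality partial_order.least_unique[OF partial_order_subspace_lattice])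

end

end

theory Submission
  imports Defs
begin

text \<open>
  For every vector space locality relation the subspaces related to \<open>U\<close> are exactly the subspaces of
  the polar space \<open>U\<^sup>\<top>\<close>. Hence the polar of \<open>U\<close> in the lattice of subspaces is always a principal
  lattice ideal with greatest element \<open>U\<^sup>\<top>\<close>, and its bipolar is the principal ideal of \<open>U\<^sup>\<top>\<^sup>\<top>\<close>. All
  the properties in question thereby become properties of the map \<open>U \<mapsto> U\<^sup>\<top>\<close>: the separating property
  says that \<open>U \<inter> U\<^sup>\<top> = {0}\<close>, which on lines is non-degeneracy, and condition (c) of strong
  separation says that \<open>U\<^sup>\<top>\<^sup>\<top> = U\<close>.

  The central point is that strong non-degeneracy implies \<open>U\<^sup>\<top>\<^sup>\<top> = U\<close>. The polar space of \<open>U + U\<^sup>\<top>\<close> is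
  \<open>U\<^sup>\<top> \<inter> U\<^sup>\<top>\<^sup>\<top> = {0}\<close>, so \<open>U + U\<^sup>\<top>\<close> is the whole space. As \<open>U \<subseteq> U\<^sup>\<top>\<^sup>\<top>\<close>, the modular law gives
  \<open>U\<^sup>\<top>\<^sup>\<top> = U + (U\<^sup>\<top> \<inter> U\<^sup>\<top>\<^sup>\<top>) = U\<close> (lemma \<open>bipolar_eq\<close>). Conversely, if \<open>U\<^sup>\<top>\<^sup>\<top> = U\<close> and \<open>U\<^sup>\<top> = {0}\<close>, then
  \<open>U = {0}\<^sup>\<top>\<close> is the whole space.
\<close>

section \<open>Polar spaces\<close>

locale locality_vector_space = vector_space scale
  for scale :: "'k::field \<Rightarrow> 'v::ab_group_add \<Rightarrow> 'v" +
  fixes R :: "'v \<Rightarrow> 'v \<Rightarrow> bool"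
  assumes locality: "vector_space_locality scale R"
begin

abbreviation perp :: "'v set \<Rightarrow> 'v set" where
  "perp A \<equiv> polar UNIV R A"

abbreviation subspaces :: "'v set gorder" where
  "subspaces \<equiv> subspace_lattice scale"

lemma R_sym: "R u w \<Longrightarrow> R w u"
  using locality by (auto simp: vector_space_locality_def dest: sympD)

lemma subspace_perp: "subspace (perp A)"
  using locality by (simp add: vector_space_locality_def)

lemma mem_perp: "x \<in> perp A \<longleftrightarrow> (\<forall>a\<in>A. R a x)"
  by (simp add: polar_def)

lemma perp_antimono: "A \<subseteq> B \<Longrightarrow> perp B \<subseteq> perp A"
  unfolding polar_def by blast

lemma perp_zero: "perp {0} = UNIV"
  using subspace_0[OF subspace_perp] R_sym unfolding polar_def by blast

lemma subset_bipolar: "A \<subseteq> perp (perp A)"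
  using R_sym unfolding polar_def by blast

lemma subspace_locality_iff: "subspace_locality R U W \<longleftrightarrow> W \<subseteq> perp U"
  by (auto simp: subspace_locality_def mem_perp)

lemma subspace_locality_sym: "subspace_locality R U W \<Longrightarrow> subspace_locality R W U"
  by (auto simp: subspace_locality_def intro: R_sym)

lemma carrier_subspaces: "carrier subspaces = {U. subspace U}"
  by (simp add: subspace_lattice_def)

lemma le_subspaces: "U \<sqsubseteq>\<^bsub>subspaces\<^esub> W \<longleftrightarrow> U \<subseteq> W"
  by (simp add: subspace_lattice_def)

section \<open>Polars in the lattice of subspaces\<close>

lemma polar_subspaces:
  "polar (carrier subspaces) (subspace_locality R) {U} = {W. subspace W \<and> W \<subseteq> perp U}"
  by (auto simp: polar_def carrier_subspaces subspace_locality_iff)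

text \<open>Among all subspaces of \<open>perp U\<close>, the space \<open>perp U\<close> itself imposes the strongest condition.\<close>

lemma bipolar_subspaces:
  "polar (carrier subspaces) (subspace_locality R)
     (polar (carrier subspaces) (subspace_locality R) {U}) =
   {W. subspace W \<and> W \<subseteq> perp (perp U)}"
proof -
  have "(\<forall>A. subspace A \<and> A \<subseteq> perp U \<longrightarrow> W \<subseteq> perp A) \<longleftrightarrow> W \<subseteq> perp (perp U)" for W
    using subspace_perp[of U] perp_antimono[of _ "perp U"] by (meson order.refl subset_trans)
  then show ?thesis
    unfolding polar_subspaces
    by (simp add: polar_def[of "Collect subspace"] carrier_subspaces subspace_locality_iff)
qed

lemma greatest_subspaces_iff:
  assumes "subspace P"
  shows "greatest subspaces U {W. subspace W \<and> W \<subseteq> P} \<longleftrightarrow> U = P"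
  using assms by (auto simp: greatest_def carrier_subspaces le_subspaces)

lemma lattice_ideal_below_subspace:
  assumes "subspace P"
  shows "lattice_ideal subspaces {W. subspace W \<and> W \<subseteq> P}"
proof -
  have "subspace {u + w | u w. u \<in> U \<and> w \<in> W}" if "subspace U" "subspace W" for U W
    using subspace_sums[OF that] by simp
  moreover have "{u + w | u w. u \<in> U \<and> w \<in> W} \<subseteq> P" if "U \<subseteq> P" "W \<subseteq> P" for U W
    using that subspace_add[OF assms] by auto
  ultimately show ?thesis
    unfolding lattice_ideal_def poset_ideal_def
    by (simp add: carrier_subspaces le_subspaces join_subspace_lattice) blast
qed

lemma locality_lattice_subspaces: "locality_lattice subspaces (subspace_locality R)"
  unfolding locality_lattice_def polar_subspaces
  by (auto intro: bounded_lattice_subspace_lattice symp_onI subspace_locality_sym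
      lattice_ideal_below_subspace subspace_perp)

section \<open>Non-degeneracy and the separating property\<close>

text \<open>A vector related to itself spans a line related to itself: since polar spaces are subspaces,
  the relation passes from \<open>v\<close> to multiples of \<open>v\<close> in either argument.\<close>

lemma subspace_locality_span_self:
  assumes "R v v"
  shows "subspace_locality R (span {v}) (span {v})"
proof -
  have "span {v} \<subseteq> perp {v}"
    using assms by (intro span_minimal subspace_perp) (simp add: mem_perp)
  then have "span {v} \<subseteq> perp (span {v})"
    by (intro span_minimal subspace_perp) (use R_sym in \<open>auto simp: mem_perp\<close>)
  then show ?thesis by (simp add: subspace_locality_iff)
qed

lemma non_degenerate_iff_separating:
  "non_degenerate R \<longleftrightarrow>
     (\<forall>U. subspace U \<longrightarrow> (\<forall>W. subspace W \<longrightarrow> subspace_locality R U W \<longrightarrow> U \<inter> W = {0}))"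
proof
  assume "non_degenerate R"
  then show "\<forall>U. subspace U \<longrightarrow>
      (\<forall>W. subspace W \<longrightarrow> subspace_locality R U W \<longrightarrow> U \<inter> W = {0})"
    by (auto simp: non_degenerate_def subspace_locality_def subspace_0)
next
  assume sep: "\<forall>U. subspace U \<longrightarrow>
      (\<forall>W. subspace W \<longrightarrow> subspace_locality R U W \<longrightarrow> U \<inter> W = {0})"
  show "non_degenerate R"
    unfolding non_degenerate_def
  proof (intro allI impI)
    fix v assume "R v v"
    then have "span {v} \<inter> span {v} = {0}"
      using sep subspace_locality_span_self by (metis subspace_span)
    then show "v = 0" using span_base[of v "{v}"] by auto
  qed
qed

lemma Int_perp_trivial:
  assumes "non_degenerate R" "subspace U"
  shows "U \<inter> perp U = {0}"
  using assms subspace_0[OF subspace_perp]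
  by (auto simp: non_degenerate_def mem_perp subspace_0)

section \<open>Strong non-degeneracy\<close>

text \<open>A vector in the polar space of \<open>U + perp U\<close> lies both in \<open>perp U\<close> and in its polar space, so it
  is zero. Strong non-degeneracy then leaves no room for \<open>U + perp U\<close> to be a proper subspace.\<close>

lemma sum_perp_eq_UNIV:
  assumes snd: "strongly_non_degenerate scale R" and U: "subspace U"
  shows "{u + w | u w. u \<in> U \<and> w \<in> perp U} = UNIV"
proof -
  let ?S = "{u + w | u w. u \<in> U \<and> w \<in> perp U}"
  have nd: "non_degenerate R" using snd by (simp add: strongly_non_degenerate_def)
  have S: "subspace ?S" using subspace_sums[OF U subspace_perp] by simp
  have "U \<subseteq> ?S" "perp U \<subseteq> ?S"
    using subspace_0[OF U] subspace_0[OF subspace_perp[of U]] by force+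
  then have "perp ?S \<subseteq> perp U \<inter> perp (perp U)" by (intro Int_greatest perp_antimono)
  also have "\<dots> = {0}" by (rule Int_perp_trivial[OF nd subspace_perp])
  finally have "perp ?S = {0}" using subspace_0[OF subspace_perp[of ?S]] by blast
  then show ?thesis using snd S unfolding strongly_non_degenerate_def by blast
qed

text \<open>The modular law in elements: decompose \<open>x \<in> perp (perp U)\<close> along \<open>U + perp U\<close>. The component
  in \<open>perp U\<close> also lies in \<open>perp (perp U)\<close>, because \<open>x\<close> and the component in \<open>U\<close> do.\<close>

lemma bipolar_eq:
  assumes snd: "strongly_non_degenerate scale R" and U: "subspace U"
  shows "perp (perp U) = U"
proof
  have nd: "non_degenerate R" using snd by (simp add: strongly_non_degenerate_def)
  show "perp (perp U) \<subseteq> U"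
  proof
    fix x assume x: "x \<in> perp (perp U)"
    have "x \<in> {u + w | u w. u \<in> U \<and> w \<in> perp U}"
      using sum_perp_eq_UNIV[OF snd U] by simp
    then obtain u w where uw: "x = u + w" "u \<in> U" "w \<in> perp U" by blast
    have "x - u \<in> perp (perp U)"
      using x uw(2) subset_bipolar by (blast intro: subspace_diff[OF subspace_perp])
    then have "w \<in> perp U \<inter> perp (perp U)" using uw by simp
    then have "w = 0" using Int_perp_trivial[OF nd subspace_perp] by blast
    then show "x \<in> U" using uw by simp
  qed
qed (rule subset_bipolar)

lemma strongly_non_degenerate_iff_bipolar:
  "strongly_non_degenerate scale R \<longleftrightarrow>
     non_degenerate R \<and> (\<forall>U. subspace U \<longrightarrow> perp (perp U) = U)"
proof
  assume "strongly_non_degenerate scale R"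
  then show "non_degenerate R \<and> (\<forall>U. subspace U \<longrightarrow> perp (perp U) = U)"
    by (simp add: bipolar_eq) (simp add: strongly_non_degenerate_def)
next
  assume bip: "non_degenerate R \<and> (\<forall>U. subspace U \<longrightarrow> perp (perp U) = U)"
  have "U = UNIV" if "subspace U" "perp U = {0}" for U
    using bip that perp_zero by metis
  with bip show "strongly_non_degenerate scale R"
    unfolding strongly_non_degenerate_def by blast
qed

text \<open>In the definition of strong separation, (a) amounts to non-degeneracy, the greatest element in (b)
  is \<open>perp U\<close>, and (c) amounts to \<open>perp (perp U) = U\<close>.\<close>

lemma strongly_separating_iff:
  "strongly_separating subspaces (subspace_locality R) \<longleftrightarrow> strongly_non_degenerate scale R"
  unfolding strongly_separating_def bipolar_subspaces
  unfolding polar_subspaces greatest_subspaces_iff[OF subspace_perp]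
    strongly_non_degenerate_iff_bipolar
    non_degenerate_iff_separating
  by (auto simp: carrier_subspaces meet_subspace_lattice bottom_subspace_lattice)

lemma orthocomplementation_perp:
  assumes snd: "strongly_non_degenerate scale R"
  shows "orthocomplementation subspaces perp"
proof -
  have nd: "non_degenerate R" using snd by (simp add: strongly_non_degenerate_def)
  have "W = {0}" if "subspace U" "subspace W" "W \<subseteq> U" "W \<subseteq> perp U" for U W
    using that Int_perp_trivial[OF nd] subspace_0 by blast
  then show ?thesis
    unfolding orthocomplementation_def
    using bounded_lattice_subspace_lattice subspace_perp bipolar_eq[OF snd] perp_antimono
    by (simp add: carrier_subspaces le_subspaces bottom_subspace_lattice)
qed

end

section \<open>Characterisation on the lattice of subspaces\<close>

theorem proposition6p4:
  fixes scale :: "'k::field \<Rightarrow> 'v::ab_group_add \<Rightarrow> 'v"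
    and Basis :: "'v set"
    and R :: "'v \<Rightarrow> 'v \<Rightarrow> bool"
  assumes "finite_dimensional_vector_space scale Basis"
    and "vector_space_locality scale R"
  shows "(non_degenerate R \<longleftrightarrow>
           locality_lattice (subspace_lattice scale) (subspace_locality R) \<and>
           (\<forall>U\<in>carrier (subspace_lattice scale). \<forall>W\<in>carrier (subspace_lattice scale).
              subspace_locality R U W \<longrightarrow> U \<inter> W = {0})) \<and>
         (strongly_non_degenerate scale R \<longleftrightarrow>
           locality_lattice (subspace_lattice scale) (subspace_locality R) \<and>
           strongly_separating (subspace_lattice scale) (subspace_locality R)) \<and>
         (strongly_non_degenerate scale R \<longrightarrow>
           orthocomplementation (subspace_lattice scale) (\<lambda>U. polar UNIV R U))"
proof -
  interpret finite_dimensional_vector_space scale Basis by fact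
  interpret locality_vector_space scale R by unfold_locales fact
  show ?thesis
    using locality_lattice_subspaces strongly_separating_iff orthocomplementation_perp
    by (simp add: non_degenerate_iff_separating carrier_subspaces)
qed

end
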